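(* Let $A\in\mathbb{Z}^{m\times n}$, $b\in\mathbb{Z}^m$, $c\in\mathbb{Z}^n$ and $u\in\mathbb{N}^n$, and let $\Delta$ be an upper bound on the absolute values of the entries of $A$. Consider the integer program $$\max\{c^Tx : Ax=b,\ 0\le x\le u,\ x\in\mathbb{Z}^n\},$$ and assume it has a feasible solution. Let $x^*$ be an optimal vertex solution of its linear programming relaxation $\max\{c^Tx : Ax=b,\ 0\le x\le u,\ x\in\mathbb{R}^n\}$. Then there exists an optimal solution $z^*$ of the integer program such that $$\|z^*-x^*\|_1 \le m\cdot (2\,m\cdot\Delta+1)^m.$$ *)

theory Defs
  imports "HOL-Analysis.Analysis"
begin

definition real_vec :: "int ^ 'n \<Rightarrow> real ^ 'n" where
  "real_vec v = (\<chi> j. real_of_int (v $ j))"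

definition lp_feasible :: "int ^ 'n ^ 'm \<Rightarrow> int ^ 'm \<Rightarrow> nat ^ 'n \<Rightarrow> (real ^ 'n) set" where
  "lp_feasible A b u =
    {x. map_matrix real_of_int A *v x = real_vec b \<and> (\<forall>j. 0 \<le> x $ j \<and> x $ j \<le> real (u $ j))}"

definition ip_feasible :: "int ^ 'n ^ 'm \<Rightarrow> int ^ 'm \<Rightarrow> nat ^ 'n \<Rightarrow> (real ^ 'n) set" where
  "ip_feasible A b u = {x \<in> lp_feasible A b u. \<forall>j. x $ j \<in> \<int>}"

definition optimal_solution :: "int ^ 'n \<Rightarrow> (real ^ 'n) set \<Rightarrow> real ^ 'n \<Rightarrow> bool" where
  "optimal_solution c S x \<longleftrightarrow> x \<in> S \<and> (\<forall>y\<in>S. real_vec c \<bullet> y \<le> real_vec c \<bullet> x)"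

definition l1_norm :: "real ^ 'n \<Rightarrow> real" where
  "l1_norm x = (\<Sum>j\<in>UNIV. \<bar>x $ j\<bar>)"

end

theory Submission
  imports Defs
begin

text \<open>
  Let \<open>z\<close> be an integer optimum closest to the vertex \<open>x\<close>. Split \<open>z - x\<close> into signed unit steps along
  the coordinates plus at most one fractional step for each fractional coordinate of \<open>x\<close>, of which a
  vertex has at most \<open>m\<close>. The corresponding multiples of columns of \<open>A\<close> sum to zero, so by the Steinitz
  lemma they can be ordered with all partial sums in a box of radius \<open>m \<Delta>\<close>. If there are too many
  steps, pigeonhole yields unit steps whose columns sum to zero, i.e. a nonzero integer kernel vector
  \<open>y\<close> conformal to \<open>z - x\<close>. Then \<open>x + y\<close> is LP-feasible and \<open>z - y\<close> is IP-feasible; optimality of \<open>x\<close>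
  makes \<open>z - y\<close> optimal as well, and it is closer to \<open>x\<close>, a contradiction.
\<close>

section \<open>Steinitz lemma: ordering a zero-sum family with bounded prefix sums\<close>

text \<open>The family is indexed because vectors may repeat. A repeated vector gives the relation
  with coefficients 1 and -1; an injective family inherits a relation from its linearly dependent
  image.\<close>

lemma nontrivial_relation:
  fixes x :: "'i \<Rightarrow> 'a::euclidean_space"
  assumes "finite I" and "DIM('a) < card I"
  obtains c where "\<exists>i\<in>I. c i \<noteq> 0" and "(\<Sum>i\<in>I. c i *\<^sub>R x i) = 0"
proof (cases "inj_on x I")
  case True
  then have "card (x ` I) > DIM('a)"
    using assms by (simp add: card_image)
  then have "dependent (x ` I)"
    using assms by (intro dependent_biggerset) auto
  then obtain g where g: "\<exists>v\<in>x ` I. g v \<noteq> 0" "(\<Sum>v\<in>x ` I. g v *\<^sub>R v) = 0"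
    using assms dependent_finite[of "x ` I"] by auto
  show thesis
  proof (rule that[of "g \<circ> x"])
    show "(\<Sum>i\<in>I. (g \<circ> x) i *\<^sub>R x i) = 0"
      using g(2) True by (simp add: sum.reindex)
  qed (use g(1) in auto)
next
  case False
  then obtain a b where ab: "a \<in> I" "b \<in> I" "a \<noteq> b" "x a = x b"
    by (auto simp: inj_on_def)
  define c :: "'i \<Rightarrow> real" where "c i = (if i = a then 1 else if i = b then -1 else 0)" for i
  show thesis
  proof (rule that[of c])
    show "\<exists>i\<in>I. c i \<noteq> 0"
      using ab(1) by (auto simp: c_def)
    have "(\<Sum>i\<in>I. c i *\<^sub>R x i) = (\<Sum>i\<in>{a, b}. c i *\<^sub>R x i)"
      using ab assms by (intro sum.mono_neutral_right) (auto simp: c_def)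
    also have "\<dots> = 0"
      using ab by (simp add: c_def)
    finally show "(\<Sum>i\<in>I. c i *\<^sub>R x i) = 0" .
  qed
qed

lemma box_boundary_step:
  fixes w c :: "'i \<Rightarrow> real"
  assumes "finite F" and "\<exists>i\<in>F. c i \<noteq> 0" and "\<And>i. i \<in> F \<Longrightarrow> 0 < w i \<and> w i < 1"
  obtains t where "\<And>i. i \<in> F \<Longrightarrow> 0 \<le> w i + t * c i \<and> w i + t * c i \<le> 1"
    and "\<exists>i\<in>F. w i + t * c i = 0 \<or> w i + t * c i = 1"
proof -
  define F' where "F' = {i \<in> F. c i \<noteq> 0}"
  \<comment> \<open>\<open>h i\<close> is the time at which coordinate \<open>i\<close>, moving from
    \<open>w i\<close> with velocity \<open>c i\<close>, leaves [0, 1]. The minimum \<open>t\<close>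
    is the first such exit, so at time \<open>t\<close> some coordinate is on the boundary and none
    is outside.\<close>
  define h where "h i = (if c i > 0 then (1 - w i) / c i else w i / (- c i))" for i
  define t where "t = Min (h ` F')"
  have fin: "finite F'" "F' \<noteq> {}"
    using assms by (auto simp: F'_def)
  have hpos: "h i > 0" if "i \<in> F'" for i
    using that assms(3)[of i] by (auto simp: F'_def h_def divide_pos_neg)
  have "t \<in> h ` F'"
    unfolding t_def using fin by (intro Min_in) auto
  then obtain a where a: "a \<in> F'" "t = h a" by auto
  have tpos: "t > 0"
    using a hpos by auto
  show thesis
  proof (rule that[of t])
    fix i assume i: "i \<in> F"
    consider "c i = 0" | "c i > 0" | "c i < 0" by linarith
    then show "0 \<le> w i + t * c i \<and> w i + t * c i \<le> 1"
    proof cases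
      case 1
      then show ?thesis using assms(3)[OF i] by simp
    next
      case 2
      then have "t \<le> (1 - w i) / c i"
        using fin i by (auto simp: t_def F'_def h_def intro!: Min.coboundedI image_eqI[of _ _ i])
      then have "t * c i \<le> 1 - w i"
        using 2 by (simp add: field_simps)
      moreover have "t * c i \<ge> 0" using 2 tpos by simp
      ultimately show ?thesis using assms(3)[OF i] by linarith
    next
      case 3
      then have "t \<le> w i / (- c i)"
        using fin i by (auto simp: t_def F'_def h_def intro!: Min.coboundedI image_eqI[of _ _ i])
      then have "t * (- c i) \<le> w i"
        using 3 by (simp only: pos_le_divide_eq neg_0_less_iff_less)
      moreover have "t * c i \<le> 0" using 3 tpos by (simp add: mult_nonneg_nonpos)
      ultimately show ?thesis using assms(3)[OF i] by (simp add: algebra_simps)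
    qed
  next
    have "w a + t * c a = 0 \<or> w a + t * c a = 1"
      using a by (auto simp: F'_def h_def field_simps)
    then show "\<exists>i\<in>F. w i + t * c i = 0 \<or> w i + t * c i = 1"
      using a by (auto simp: F'_def)
  qed
qed

text \<open>As for basic solutions of a linear program: more fractional weights than dimensions
  admit a linear relation among their vectors. Sliding along it keeps the weighted sum and brings a
  fractional weight to 0 or 1, so the number of fractional weights drops.\<close>

lemma few_fractional_weights:
  fixes x :: "'i \<Rightarrow> 'a::euclidean_space" and w :: "'i \<Rightarrow> real"
  assumes fin: "finite I" and "\<And>i. i \<in> I \<Longrightarrow> 0 \<le> w i \<and> w i \<le> 1"
  shows "\<exists>w'. (\<forall>i\<in>I. 0 \<le> w' i \<and> w' i \<le> 1) \<and> (\<Sum>i\<in>I. w' i *\<^sub>R x i) = (\<Sum>i\<in>I. w i *\<^sub>R x i)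
    \<and> card {i\<in>I. 0 < w' i \<and> w' i < 1} \<le> DIM('a)"
  using assms(2)
proof (induction "card {i\<in>I. 0 < w i \<and> w i < 1}" arbitrary: w rule: less_induct)
  case less
  define F where "F = {i\<in>I. 0 < w i \<and> w i < 1}"
  show ?case
  proof (cases "card F \<le> DIM('a)")
    case True
    then show ?thesis using less.prems by (auto simp: F_def intro!: exI[of _ w])
  next
    case False
    have finF: "finite F" using fin by (simp add: F_def)
    obtain c where c: "\<exists>i\<in>F. c i \<noteq> 0" "(\<Sum>i\<in>F. c i *\<^sub>R x i) = 0"
      using nontrivial_relation[OF finF, of x] False by auto
    obtain t where t: "\<And>i. i \<in> F \<Longrightarrow> 0 \<le> w i + t * c i \<and> w i + t * c i \<le> 1"
      "\<exists>i\<in>F. w i + t * c i = 0 \<or> w i + t * c i = 1"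
      using box_boundary_step[OF finF c(1), of w] by (auto simp: F_def)
    define v where "v i = (if i \<in> F then w i + t * c i else w i)" for i
    have v01: "0 \<le> v i \<and> v i \<le> 1" if "i \<in> I" for i
      using that less.prems t(1) by (auto simp: v_def)
    have sub: "{i\<in>I. 0 < v i \<and> v i < 1} \<subset> F"
    proof -
      have "{i\<in>I. 0 < v i \<and> v i < 1} \<subseteq> F"
        unfolding v_def F_def by (auto split: if_splits)
      moreover obtain a where "a \<in> F" "v a = 0 \<or> v a = 1"
        using t(2) by (auto simp: v_def)
      ultimately show ?thesis by (force simp: F_def)
    qed
    have "(\<Sum>i\<in>I. v i *\<^sub>R x i) = (\<Sum>i\<in>I. w i *\<^sub>R x i + (if i \<in> F then t *\<^sub>R (c i *\<^sub>R x i) else 0))"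
      by (intro sum.cong) (auto simp: v_def algebra_simps)
    also have "\<dots> = (\<Sum>i\<in>I. w i *\<^sub>R x i) + (\<Sum>i\<in>F. t *\<^sub>R (c i *\<^sub>R x i))"
      using fin by (simp add: sum.distrib F_def sum.inter_filter del: scaleR_scaleR)
    also have "(\<Sum>i\<in>F. t *\<^sub>R (c i *\<^sub>R x i)) = 0"
      using c(2) by (simp only: scaleR_sum_right[symmetric]) simp
    finally have eq: "(\<Sum>i\<in>I. v i *\<^sub>R x i) = (\<Sum>i\<in>I. w i *\<^sub>R x i)" by simp
    have "card {i\<in>I. 0 < v i \<and> v i < 1} < card F"
      using sub finF by (rule psubset_card_mono[rotated])
    from less.hyps[OF this[unfolded F_def] v01] eq show ?thesis by auto
  qed
qed

text \<open>The invariant of the Grinberg--Sevastyanov proof of the Steinitz lemma: weights of total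
  defect at most the dimension certify that the unweighted sum is small.\<close>

definition small_defect :: "('i \<Rightarrow> real ^ 'm) \<Rightarrow> 'i set \<Rightarrow> bool" where
  "small_defect x I \<longleftrightarrow> (\<exists>w. (\<forall>i\<in>I. 0 \<le> w i \<and> w i \<le> 1) \<and> (\<Sum>i\<in>I. w i *\<^sub>R x i) = 0
     \<and> (\<Sum>i\<in>I. 1 - w i) \<le> real CARD('m))"

text \<open>As the \<open>w\<close>-weighted sum vanishes, the plain sum equals the sum with weights
  \<open>1 - w i\<close>, which are nonnegative and total at most the dimension.\<close>

lemma small_defect_bound:
  fixes x :: "'i \<Rightarrow> real ^ 'm"
  assumes "small_defect x I" and "\<And>i. i \<in> I \<Longrightarrow> \<bar>x i $ l\<bar> \<le> D" and "0 \<le> D"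
  shows "\<bar>(\<Sum>i\<in>I. x i) $ l\<bar> \<le> real CARD('m) * D"
proof -
  obtain w where w: "\<forall>i\<in>I. 0 \<le> w i \<and> w i \<le> 1" "(\<Sum>i\<in>I. w i *\<^sub>R x i) = 0"
    "(\<Sum>i\<in>I. 1 - w i) \<le> real CARD('m)"
    using assms(1) by (auto simp: small_defect_def)
  have "(\<Sum>i\<in>I. x i) = (\<Sum>i\<in>I. (1 - w i) *\<^sub>R x i)"
    using w(2) by (simp add: algebra_simps sum_subtractf)
  then have "\<bar>(\<Sum>i\<in>I. x i) $ l\<bar> = \<bar>\<Sum>i\<in>I. (1 - w i) * x i $ l\<bar>"
    by simp
  also have "\<dots> \<le> (\<Sum>i\<in>I. \<bar>(1 - w i) * x i $ l\<bar>)"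
    by (rule sum_abs)
  also have "\<dots> \<le> (\<Sum>i\<in>I. (1 - w i) * D)"
    using w(1) assms(2) by (intro sum_mono) (auto simp: abs_mult intro!: mult_mono)
  also have "\<dots> = (\<Sum>i\<in>I. 1 - w i) * D"
    by (simp add: sum_distrib_right)
  also have "\<dots> \<le> real CARD('m) * D"
    using w(3) assms(3) by (rule mult_right_mono)
  finally show ?thesis .
qed

text \<open>Scale the weights down to a total that suits one index fewer, then make most of them 0
  or 1. Counting shows that some weight is now 0, and its index can go.\<close>

lemma small_defect_remove:
  fixes x :: "'i \<Rightarrow> real ^ 'm"
  assumes fin: "finite I" and "I \<noteq> {}" and "small_defect x I"
  shows "\<exists>i\<in>I. small_defect x (I - {i})"
proof (cases "card I \<le> Suc CARD('m)")
  case True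
  obtain i where i: "i \<in> I" using assms by auto
  then have "real (card (I - {i})) \<le> real CARD('m)"
    using True fin by simp
  \<comment> \<open>At most m vectors remain, so zero weights already have defect at most m.\<close>
  then have "small_defect x (I - {i})"
    by (auto simp: small_defect_def intro!: exI[of _ "\<lambda>_. 0"])
  then show ?thesis using i by auto
next
  case False
  obtain w where w: "\<forall>i\<in>I. 0 \<le> w i \<and> w i \<le> 1" "(\<Sum>i\<in>I. w i *\<^sub>R x i) = 0"
    "(\<Sum>i\<in>I. 1 - w i) \<le> real CARD('m)"
    using assms(3) by (auto simp: small_defect_def)
  define W where "W = (\<Sum>i\<in>I. w i)"
  \<comment> \<open>A total of \<open>S\<close> on \<open>card I - 1\<close> indices means a defect
    of exactly m.\<close>
  define S where "S = real (card I) - real CARD('m) - 1"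
  have S: "S > 0" using False by (simp add: S_def)
  \<comment> \<open>Defect at most m gives \<open>W\<close> at least \<open>S + 1\<close>, so the
    factor \<open>S / W\<close> only shrinks weights.\<close>
  have W: "W > S" using w(3) by (simp add: S_def W_def sum_subtractf)
  define v where "v i = (S / W) * w i" for i
  have v01: "0 \<le> v i \<and> v i \<le> 1" if "i \<in> I" for i
  proof -
    have "0 \<le> S / W" "S / W \<le> 1" using S W by auto
    then show ?thesis using w(1) that unfolding v_def by (intro conjI mult_nonneg_nonneg mult_le_one) auto
  qed
  have v0: "(\<Sum>i\<in>I. v i *\<^sub>R x i) = 0"
  proof -
    have "(\<Sum>i\<in>I. v i *\<^sub>R x i) = (S / W) *\<^sub>R (\<Sum>i\<in>I. w i *\<^sub>R x i)"
      by (simp add: v_def scaleR_sum_right)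
    then show ?thesis using w(2) by simp
  qed
  have vS: "(\<Sum>i\<in>I. v i) = S"
    using S W unfolding v_def sum_distrib_left[symmetric] W_def[symmetric] by simp
  \<comment> \<open>The extra component 1 preserves the total weight along with the vector sum, at
    the price of one more dimension: up to m + 1 fractional weights.\<close>
  obtain q where q: "\<forall>i\<in>I. 0 \<le> q i \<and> q i \<le> 1"
    "(\<Sum>i\<in>I. q i *\<^sub>R (x i, 1::real)) = (\<Sum>i\<in>I. v i *\<^sub>R (x i, 1::real))"
    "card {i\<in>I. 0 < q i \<and> q i < 1} \<le> DIM((real ^ 'm) \<times> real)"
    using few_fractional_weights[where w = v and x = "\<lambda>i. (x i, 1::real)", OF fin v01]
    by auto
  have pair: "(\<Sum>i\<in>I. g i *\<^sub>R (x i, 1::real)) = (\<Sum>i\<in>I. g i *\<^sub>R x i, \<Sum>i\<in>I. g i)" for g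
    by (simp add: sum_prod)
  have q0: "(\<Sum>i\<in>I. q i *\<^sub>R x i) = 0" and qS: "(\<Sum>i\<in>I. q i) = S"
    using q(2) unfolding pair v0 vS by auto
  define F where "F = {i\<in>I. 0 < q i \<and> q i < 1}"
  have cF: "card F \<le> Suc CARD('m)" using q(3) by (simp add: F_def)
  have FI: "F \<subseteq> I" by (auto simp: F_def)
  \<comment> \<open>Without a zero weight, everything outside \<open>F\<close> has weight 1. The at
    most m + 1 weights in \<open>F\<close> are positive, so the total would exceed card I - m - 1,
    which is \<open>S\<close>.\<close>
  have "\<exists>i\<in>I. q i = 0"
  proof (rule ccontr)
    assume no: "\<not> ?thesis"
    then have one: "q i = 1" if "i \<in> I - F" for i
      using that q(1) by (force simp: F_def)
    have "S = (\<Sum>i\<in>I - F. q i) + (\<Sum>i\<in>F. q i)"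
      using qS sum.subset_diff[OF FI fin, of q] by simp
    also have "(\<Sum>i\<in>I - F. q i) = real (card I) - real (card F)"
      using one FI fin by (simp add: card_Diff_subset finite_subset card_mono)
    finally have eq: "S = real (card I) - real (card F) + (\<Sum>i\<in>F. q i)" .
    have "F \<noteq> {}" using eq by (auto simp: S_def)
    then have "(\<Sum>i\<in>F. q i) > 0"
      using FI fin by (intro sum_pos) (auto simp: F_def)
    with eq cF show False by (simp add: S_def)
  qed
  then obtain i where i: "i \<in> I" "q i = 0" by auto
  have rem: "(\<Sum>k\<in>I - {i}. q k *\<^sub>R x k) = 0" "(\<Sum>k\<in>I - {i}. q k) = S"
    using q0 qS sum.remove[OF fin i(1), of "\<lambda>k. q k *\<^sub>R x k"] sum.remove[OF fin i(1), of q] i(2)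
    by auto
  have "card I > 0" using False by auto
  then have "(\<Sum>k\<in>I - {i}. 1 - q k) \<le> real CARD('m)"
    using i fin by (simp add: sum_subtractf rem S_def Suc_le_eq)
  then have "small_defect x (I - {i})"
    using q(1) rem(1) by (auto simp: small_defect_def)
  then show ?thesis using i by auto
qed

text \<open>The order is filled from the back: a removable index goes last and the rest is ordered
  by induction.\<close>

lemma small_defect_ordering:
  fixes x :: "'i \<Rightarrow> real ^ 'm"
  assumes "finite I" and "small_defect x I"
  shows "\<exists>f. bij_betw f {..<card I} I \<and> (\<forall>k\<le>card I. small_defect x (f ` {..<k}))"
  using assms
proof (induction "card I" arbitrary: I)
  case 0
  then show ?case by (auto simp: bij_betw_def)
next
  case (Suc n)
  obtain i where i: "i \<in> I" "small_defect x (I - {i})"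
    using small_defect_remove[OF Suc.prems(1) _ Suc.prems(2)] Suc.hyps(2) by fastforce
  have cn: "card (I - {i}) = n" using i Suc by simp
  obtain f where f: "bij_betw f {..<n} (I - {i})" "\<forall>k\<le>n. small_defect x (f ` {..<k})"
    using Suc.hyps(1)[of "I - {i}"] cn i(2) Suc.prems(1) by auto
  define g where "g = f(n := i)"
  have gim: "g ` {..<k} = f ` {..<k}" if "k \<le> n" for k
    using that by (auto simp: g_def)
  have "bij_betw g {..<n} (I - {i})"
    using f(1) by (subst bij_betw_cong[of _ _ f]) (auto simp: g_def)
  then have "bij_betw g ({..<n} \<union> {n}) (I - {i} \<union> {g n})"
    by (intro notIn_Un_bij_betw) (auto simp: g_def)
  then have bij: "bij_betw g {..<Suc n} I"
    using i by (simp add: g_def lessThan_Suc insert_absorb)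
  have "small_defect x (g ` {..<k})" if "k \<le> Suc n" for k
  proof (cases "k = Suc n")
    case True
    then show ?thesis using bij Suc.prems(2) by (simp add: bij_betw_def)
  next
    case False
    then show ?thesis using that gim f(2) by simp
  qed
  then show ?case using bij Suc.hyps(2) by auto
qed

text \<open>Weights equal to 1 have defect zero and start the invariant;
  \<open>small_defect_bound\<close> then applies to every prefix.\<close>

lemma steinitz:
  fixes x :: "'i \<Rightarrow> real ^ 'm"
  assumes "finite I" and "(\<Sum>i\<in>I. x i) = 0" and "\<And>i l. i \<in> I \<Longrightarrow> \<bar>x i $ l\<bar> \<le> D" and "0 \<le> D"
  obtains f where "bij_betw f {..<card I} I"
    and "\<And>k l. k \<le> card I \<Longrightarrow> \<bar>(\<Sum>i<k. x (f i)) $ l\<bar> \<le> real CARD('m) * D"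
proof -
  have "small_defect x I"
    using assms(2) by (auto simp: small_defect_def intro!: exI[of _ "\<lambda>_. 1"])
  then obtain f where f: "bij_betw f {..<card I} I" "\<forall>k\<le>card I. small_defect x (f ` {..<k})"
    using small_defect_ordering[OF assms(1)] by blast
  show thesis
  proof (rule that[OF f(1)])
    fix k l assume k: "k \<le> card I"
    have inj: "inj_on f {..<k}" and sub: "f ` {..<k} \<subseteq> I"
      using f(1) k by (auto simp: bij_betw_def intro: inj_on_subset)
    have "\<bar>(\<Sum>i\<in>f ` {..<k}. x i) $ l\<bar> \<le> real CARD('m) * D"
      using f(2) k sub assms by (intro small_defect_bound) auto
    then show "\<bar>(\<Sum>i<k. x (f i)) $ l\<bar> \<le> real CARD('m) * D"
      by (simp only: sum.reindex[OF inj] o_def)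
  qed
qed

section \<open>Pigeonhole on the partial sums\<close>

text \<open>Subtracting a fixed \<open>q\<close> in \<open>P\<close> turns all points into integer
  vectors. Each coordinate then ranges over an interval of length 2R, which holds at most 2R + 1
  integers.\<close>

lemma card_integer_coset_box:
  fixes P :: "(real ^ 'm) set"
  assumes "0 \<le> R" and box: "\<And>p l. p \<in> P \<Longrightarrow> \<bar>p $ l\<bar> \<le> R"
    and int: "\<And>p q l. p \<in> P \<Longrightarrow> q \<in> P \<Longrightarrow> p $ l - q $ l \<in> \<int>"
  shows "real (card P) \<le> (2 * R + 1) ^ CARD('m)"
proof (cases "P = {}")
  case True
  then show ?thesis using assms(1) by simp
next
  case False
  then obtain q where q: "q \<in> P" by auto
  define B where "B l = {\<lceil>- R - q $ l\<rceil>..\<lfloor>R - q $ l\<rfloor>}" for l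
  define \<phi> where "\<phi> p = (\<lambda>l. \<lfloor>p $ l - q $ l\<rfloor>)" for p :: "real ^ 'm"
  have fl: "of_int (\<phi> p l) = p $ l - q $ l" if "p \<in> P" for p l
    using int[OF that q, of l] by (auto simp: \<phi>_def elim: Ints_cases)
  have inj: "inj_on \<phi> P"
  proof (rule inj_onI)
    fix p p' assume pp: "p \<in> P" "p' \<in> P" "\<phi> p = \<phi> p'"
    then have "p $ l - q $ l = p' $ l - q $ l" for l
      using fl[of p l] fl[of p' l] by simp
    then show "p = p'" by (simp add: vec_eq_iff)
  qed
  have sub: "\<phi> ` P \<subseteq> Pi\<^sub>E UNIV B"
  proof (clarsimp simp: PiE_UNIV_domain)
    fix p l assume p: "p \<in> P"
    have "\<bar>p $ l\<bar> \<le> R" by (rule box[OF p])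
    then have "- R - q $ l \<le> of_int (\<phi> p l)" "of_int (\<phi> p l) \<le> R - q $ l"
      unfolding fl[OF p] by linarith+
    then show "\<phi> p l \<in> B l" by (simp add: B_def ceiling_le le_floor_iff)
  qed
  have cB: "real (card (B l)) \<le> 2 * R + 1" for l
    using assms(1) by (simp add: B_def) linarith
  have "card P = card (\<phi> ` P)" using inj by (simp add: card_image)
  also have "\<dots> \<le> card (Pi\<^sub>E UNIV B)"
    using sub by (intro card_mono finite_PiE) (auto simp: B_def)
  also have "\<dots> = (\<Prod>l\<in>UNIV. card (B l))" by (simp add: card_PiE)
  finally have "real (card P) \<le> (\<Prod>l\<in>UNIV. real (card (B l)))"
    by (metis of_nat_le_iff of_nat_prod)
  also have "\<dots> \<le> (\<Prod>l\<in>(UNIV :: 'm set). 2 * R + 1)"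
    using cB by (intro prod_mono) auto
  also have "\<dots> = (2 * R + 1) ^ CARD('m)" by simp
  finally show ?thesis .
qed

text \<open>In a Steinitz ordering, two partial sums separated by no non-integral vector differ by an
  integer vector. As the whole sequence sums to zero it may be read cyclically, so the \<open>k\<close>
  non-integral vectors cut it into only \<open>max k 1\<close> stretches; a stretch with more partial sums than
  the box has points of a coset of the integer lattice repeats one of them.\<close>

lemma integral_zero_sum_subset:
  fixes x :: "'i \<Rightarrow> real ^ 'm"
  assumes fin: "finite I" and sum0: "(\<Sum>i\<in>I. x i) = 0"
    and bd: "\<And>i l. i \<in> I \<Longrightarrow> \<bar>x i $ l\<bar> \<le> D" and D: "0 \<le> D"
    and G: "G \<subseteq> I" and int: "\<And>i l. i \<in> G \<Longrightarrow> x i $ l \<in> \<int>"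
    and few: "card (I - G) \<le> CARD('m)"
    and many: "real (card I) > real CARD('m) * (2 * real CARD('m) * D + 1) ^ CARD('m)"
  obtains J where "J \<subseteq> G" and "J \<noteq> {}" and "(\<Sum>i\<in>J. x i) = 0"
proof -
  define T where "T = card I"
  define k where "k = card (I - G)"
  obtain f where f: "bij_betw f {..<T} I"
    and st: "\<And>k l. k \<le> T \<Longrightarrow> \<bar>(\<Sum>i<k. x (f i)) $ l\<bar> \<le> real CARD('m) * D"
    using steinitz[OF fin sum0 bd D] unfolding T_def by metis
  define p where "p i = (\<Sum>r<i. x (f r))" for i
  define cnt where "cnt i = card {r. r < i \<and> f r \<notin> G}" for i
  \<comment> \<open>\<open>cnt\<close> numbers the stretches from 0 to \<open>k\<close>; the last is
    merged with the first, its cyclic neighbour.\<close>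
  define cls where "cls i = (if cnt i = k then 0 else cnt i)" for i
  have inj: "inj_on f {..<T}" and im: "f ` {..<T} = I"
    using f by (auto simp: bij_betw_def)
  have pT: "p T = 0"
    using sum0 unfolding p_def im[symmetric] sum.reindex[OF inj] o_def .
  have cT: "cnt T = k"
  proof -
    have "f ` {r. r < T \<and> f r \<notin> G} = I - G" using im by auto
    moreover have "inj_on f {r. r < T \<and> f r \<notin> G}" by (rule inj_on_subset[OF inj]) auto
    ultimately show ?thesis unfolding cnt_def k_def by (metis card_image)
  qed
  have cle: "cnt i \<le> cnt j" if "i \<le> j" for i j
    unfolding cnt_def using that by (intro card_mono) auto
  have same_cnt: "f r \<in> G" if "i \<le> j" "cnt i = cnt j" "i \<le> r" "r < j" for i j r
  proof (rule ccontr)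
    assume "f r \<notin> G"
    then have "r \<in> {r. r < j \<and> f r \<notin> G} - {r. r < i \<and> f r \<notin> G}"
      using that(3,4) by simp
    moreover have "{r. r < i \<and> f r \<notin> G} \<subseteq> {r. r < j \<and> f r \<notin> G}"
      using that(1) by auto
    ultimately have "{r. r < i \<and> f r \<notin> G} \<subset> {r. r < j \<and> f r \<notin> G}" by blast
    then have "cnt i < cnt j" unfolding cnt_def by (intro psubset_card_mono) auto
    then show False using that by simp
  qed
  have split: "(\<Sum>r\<in>{i..<j}. x (f r)) = p j - p i" if "i \<le> j" for i j
    using sum_diff_nat_ivl[of 0 i j "\<lambda>r. x (f r)"] that by (simp add: p_def atLeast0LessThan)
  have key: "\<exists>J\<subseteq>G. J \<noteq> {} \<and> ((\<Sum>i\<in>J. x i) = p j - p i \<or> (\<Sum>i\<in>J. x i) = p i - p j)"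
    if ij: "i < j" "j < T" and c: "cls i = cls j" for i j
  proof -
    have le: "cnt i \<le> cnt j" "cnt j \<le> k"
      using ij cle[of i j] cle[of j T] cT by auto
    have reindex: "(\<Sum>i\<in>f ` R. x i) = (\<Sum>r\<in>R. x (f r))" if "R \<subseteq> {..<T}" for R
      using sum.reindex[OF inj_on_subset[OF inj that], of x] by (simp add: o_def)
    show ?thesis
    proof (cases "cnt i = cnt j")
      case True
      have "f ` {i..<j} \<subseteq> G" using same_cnt[OF _ True] ij by auto
      moreover have "(\<Sum>i\<in>f ` {i..<j}. x i) = p j - p i"
        using ij by (subst reindex) (auto simp: split)
      ultimately show ?thesis using ij by (intro exI[of _ "f ` {i..<j}"]) auto
    next
      case False
      \<comment> \<open>Equal classes with different counts can only be the merged pair: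
        \<open>i\<close> is in the first stretch and \<open>j\<close> in the last. The steps outside
        the interval from \<open>i\<close> to \<open>j\<close> are then all in \<open>G\<close>, and
        since \<open>p T = 0\<close> they sum to \<open>p i - p j\<close>.\<close>
      then have c0: "cnt i = cnt 0" "cnt j = cnt T"
        using c le cT by (auto simp: cls_def cnt_def split: if_splits)
      have "f ` ({0..<i} \<union> {j..<T}) \<subseteq> G"
        using same_cnt[of 0 i] same_cnt[of j T] c0 ij by auto
      moreover have "(\<Sum>i\<in>f ` ({0..<i} \<union> {j..<T}). x i) = p i - p j"
      proof -
        have "(\<Sum>i\<in>f ` ({0..<i} \<union> {j..<T}). x i) = (\<Sum>r\<in>{0..<i} \<union> {j..<T}. x (f r))"
          using ij by (intro reindex) auto
        also have "\<dots> = (\<Sum>r\<in>{0..<i}. x (f r)) + (\<Sum>r\<in>{j..<T}. x (f r))"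
          using ij by (intro sum.union_disjoint) auto
        also have "\<dots> = p i - p j"
          using ij pT split[of 0 i] split[of j T] by (simp add: p_def)
        finally show ?thesis .
      qed
      ultimately show ?thesis using ij by (intro exI[of _ "f ` ({0..<i} \<union> {j..<T})"]) auto
    qed
  qed
  define N where "N = (2 * real CARD('m) * D + 1) ^ CARD('m)"
  define C where "C q = {i. i < T \<and> cls i = q}" for q
  \<comment> \<open>Within a class, partial sums differ by integer vectors. If they were all
    distinct, each class would have at most \<open>N\<close> positions, and at most m classes would
    make \<open>T\<close> too small.\<close>
  have "\<exists>q. \<not> inj_on p (C q)"
  proof (rule ccontr)
    assume "\<not> ?thesis"
    then have injp: "inj_on p (C q)" for q by auto
    have cC: "real (card (C q)) \<le> N" for q
    proof -
      have intd: "p i $ l - p j $ l \<in> \<int>" if h: "i < j" "j < T" "cls i = cls j" for i j l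
      proof -
        obtain J where J: "J \<subseteq> G" "(\<Sum>i\<in>J. x i) = p j - p i \<or> (\<Sum>i\<in>J. x i) = p i - p j"
          using key[OF h] by blast
        have "(\<Sum>i\<in>J. x i) $ l \<in> \<int>"
          using J(1) int by auto
        with J(2) show ?thesis
          by (metis Ints_minus minus_diff_eq vector_minus_component)
      qed
      have "real (card (p ` C q)) \<le> (2 * (real CARD('m) * D) + 1) ^ CARD('m)"
      proof (rule card_integer_coset_box)
        fix a b l assume "a \<in> p ` C q" "b \<in> p ` C q"
        then obtain i j where ij: "a = p i" "b = p j" "i \<in> C q" "j \<in> C q" by auto
        consider "i < j" | "i = j" | "j < i" by linarith
        then show "a $ l - b $ l \<in> \<int>"
        proof cases
          case 1
          then show ?thesis using ij intd[of i j l] by (simp add: C_def)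
        next
          case 2
          then show ?thesis using ij by simp
        next
          case 3
          then have "p j $ l - p i $ l \<in> \<int>" using ij intd[of j i l] by (simp add: C_def)
          then show ?thesis using ij by (metis Ints_minus minus_diff_eq)
        qed
      qed (use D st in \<open>auto simp: C_def p_def\<close>)
      then show ?thesis using injp[of q] by (simp add: card_image N_def mult.assoc)
    qed
    \<comment> \<open>Merging stretch \<open>k\<close> into stretch 0 keeps this strict even when
      \<open>k\<close> equals m; it yields a factor m instead of m + 1.\<close>
    have lt: "cls i < CARD('m)" if "i < T" for i
    proof -
      have "cnt i \<le> k" using cle[of i T] that cT by simp
      moreover have "k \<le> CARD('m)" "0 < CARD('m)" using few by (auto simp: k_def)
      ultimately show ?thesis by (auto simp: cls_def)
    qed
    have "{..<T} = (\<Union>q<CARD('m). C q)" using lt by (auto simp: C_def)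
    then have "T = card (\<Union>q<CARD('m). C q)" by (metis card_lessThan)
    also have "\<dots> \<le> (\<Sum>q<CARD('m). card (C q))" by (rule card_UN_le) simp
    finally have "real T \<le> (\<Sum>q<CARD('m). real (card (C q)))"
      by (metis of_nat_le_iff of_nat_sum)
    also have "\<dots> \<le> (\<Sum>q<CARD('m). N)" using cC by (intro sum_mono) auto
    also have "\<dots> = real CARD('m) * N" by simp
    finally show False using many by (simp add: T_def N_def)
  qed
  then obtain q i j where ij: "i \<in> C q" "j \<in> C q" "p i = p j" "i \<noteq> j"
    by (auto simp: inj_on_def)
  obtain i' j' where ij': "i' < j'" "j' < T" "cls i' = cls j'" "p i' = p j'"
  proof (cases "i < j")
    case True
    then show thesis using that[of i j] ij by (simp add: C_def)
  next
    case False
    then show thesis using that[of j i] ij by (simp add: C_def)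
  qed
  obtain J where "J \<subseteq> G" "J \<noteq> {}" "(\<Sum>i\<in>J. x i) = 0"
    using key[OF ij'(1-3)] ij'(4) by auto
  then show thesis by (rule that)
qed

section \<open>Vertices, finiteness, and integer kernel vectors conformal to a difference\<close>

lemma sum_unit_pieces:
  fixes a :: real
  assumes "0 \<le> a"
  shows "(\<Sum>r<nat \<lceil>a\<rceil>. min 1 (a - real r)) = a"
proof (cases "nat \<lceil>a\<rceil>")
  case 0
  then show ?thesis using assms by simp
next
  case (Suc k)
  then have k: "real k < a" "a \<le> real k + 1" by linarith+
  have "(\<Sum>r<k. min 1 (a - real r)) = (\<Sum>r<k. 1)"
    using k by (intro sum.cong) auto
  then show ?thesis using k Suc by simp
qed

lemma matrix_vector_mult_columns:
  fixes A :: "real ^ 'n ^ 'm"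
  shows "A *v x = (\<Sum>j\<in>UNIV. x $ j *\<^sub>R column j A)"
  by (simp add: vec_eq_iff matrix_vector_mult_def column_def mult.commute)

text \<open>More than m columns at fractional coordinates are dependent, which gives a kernel
  direction \<open>d\<close> supported there. These coordinates have slack on both sides, so small
  steps along \<open>d\<close> and \<open>-d\<close> stay feasible and put \<open>x\<close> inside a
  segment.\<close>

lemma vertex_few_fractional:
  fixes A :: "int ^ 'n ^ 'm"
  assumes ext: "x extreme_point_of lp_feasible A b u"
  shows "card {j. x $ j \<notin> \<int>} \<le> CARD('m)"
proof (rule ccontr)
  define F where "F = {j. x $ j \<notin> \<int>}"
  define M where "M = map_matrix real_of_int A"
  assume "\<not> ?thesis"
  then have "DIM(real ^ 'm) < card F" by (simp add: F_def)
  then obtain c where c: "\<exists>j\<in>F. c j \<noteq> 0" "(\<Sum>j\<in>F. c j *\<^sub>R column j M) = 0"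
    using nontrivial_relation[of F "\<lambda>j. column j M"] by auto
  define d where "d = (\<chi> j. if j \<in> F then c j else 0)"
  have Md: "M *v d = 0"
  proof -
    have "M *v d = (\<Sum>j\<in>UNIV. if j \<in> F then c j *\<^sub>R column j M else 0)"
      unfolding matrix_vector_mult_columns by (intro sum.cong) (auto simp: d_def)
    also have "\<dots> = 0" using c(2) by (simp add: sum.If_cases)
    finally show ?thesis .
  qed
  have x: "x \<in> lp_feasible A b u" using ext by (simp add: extreme_point_of_def)
  \<comment> \<open>Both bounds are integers, so a non-integral coordinate attains neither.\<close>
  have fr: "0 < x $ j \<and> x $ j < real (u $ j)" if "j \<in> F" for j
  proof -
    have "0 \<le> x $ j" "x $ j \<le> real (u $ j)" using x by (auto simp: lp_feasible_def)
    moreover have "x $ j \<noteq> 0" "x $ j \<noteq> real (u $ j)" using that by (auto simp: F_def)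
    ultimately show ?thesis by linarith
  qed
  have ev: "\<forall>\<^sub>F e in at_right 0. 0 \<le> x $ j + e * d $ j \<and> x $ j + e * d $ j \<le> real (u $ j)
      \<and> 0 \<le> x $ j - e * d $ j \<and> x $ j - e * d $ j \<le> real (u $ j)" for j
  proof (cases "j \<in> F")
    case True
    have l1: "((\<lambda>e. x $ j + e * d $ j) \<longlongrightarrow> x $ j + 0 * d $ j) (at_right 0)"
      by (intro tendsto_intros)
    have l2: "((\<lambda>e. x $ j - e * d $ j) \<longlongrightarrow> x $ j - 0 * d $ j) (at_right 0)"
      by (intro tendsto_intros)
    have "\<forall>\<^sub>F e in at_right 0. x $ j + e * d $ j > 0" "\<forall>\<^sub>F e in at_right 0. x $ j + e * d $ j < real (u $ j)"
      "\<forall>\<^sub>F e in at_right 0. x $ j - e * d $ j > 0" "\<forall>\<^sub>F e in at_right 0. x $ j - e * d $ j < real (u $ j)"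
      using fr[OF True] order_tendstoD[OF l1] order_tendstoD[OF l2] by (simp_all del: diff_gt_0_iff_gt)
    then show ?thesis by eventually_elim auto
  next
    case False
    then show ?thesis using x by (simp add: d_def lp_feasible_def)
  qed
  have "\<forall>\<^sub>F e in at_right 0. \<forall>j. 0 \<le> x $ j + e * d $ j \<and> x $ j + e * d $ j \<le> real (u $ j)
      \<and> 0 \<le> x $ j - e * d $ j \<and> x $ j - e * d $ j \<le> real (u $ j)"
    using ev by (rule eventually_all_finite)
  moreover have "\<forall>\<^sub>F e in at_right (0::real). e > 0" by (rule eventually_at_right_less)
  ultimately have "\<forall>\<^sub>F e in at_right 0. e > 0 \<and> (\<forall>j. 0 \<le> x $ j + e * d $ j \<and> x $ j + e * d $ j \<le> real (u $ j)
      \<and> 0 \<le> x $ j - e * d $ j \<and> x $ j - e * d $ j \<le> real (u $ j))"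
    by eventually_elim auto
  then obtain e where e: "e > 0" "\<forall>j. 0 \<le> x $ j + e * d $ j \<and> x $ j + e * d $ j \<le> real (u $ j)
      \<and> 0 \<le> x $ j - e * d $ j \<and> x $ j - e * d $ j \<le> real (u $ j)"
    using eventually_happens'[OF trivial_limit_at_right_real] by blast
  have Mx: "M *v x = real_vec b" using x by (simp add: lp_feasible_def M_def)
  have in1: "x + e *\<^sub>R d \<in> lp_feasible A b u"
    using e(2) Mx Md by (simp add: lp_feasible_def M_def[symmetric] matrix_vector_right_distrib matrix_vector_mult_scaleR)
  have in2: "x - e *\<^sub>R d \<in> lp_feasible A b u"
    using e(2) Mx Md by (simp add: lp_feasible_def M_def[symmetric] matrix_vector_mult_diff_distrib matrix_vector_mult_scaleR)
  have "d \<noteq> 0" using c(1) by (auto simp: d_def vec_eq_iff)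
  then have ne: "x - e *\<^sub>R d \<noteq> x + e *\<^sub>R d"
    using e(1) by (simp add: vec_eq_iff)
  have "x = midpoint (x - e *\<^sub>R d) (x + e *\<^sub>R d)"
    by (simp add: midpoint_def vec_eq_iff)
  then have "x \<in> open_segment (x - e *\<^sub>R d) (x + e *\<^sub>R d)"
    using midpoint_in_open_segment ne by metis
  then show False using ext in1 in2 by (auto simp: extreme_point_of_def)
qed

lemma finite_ip_feasible: "finite (ip_feasible A b u)"
proof -
  define S where "S = {v :: real ^ 'a. \<forall>j. v $ j \<in> real ` {..u $ j}}"
  have "finite S"
  proof (rule finite_subset)
    show "S \<subseteq> vec_lambda ` Pi\<^sub>E UNIV (\<lambda>j. real ` {..u $ j})"
    proof
      fix v assume "v \<in> S"
      then have "vec_nth v \<in> Pi\<^sub>E UNIV (\<lambda>j. real ` {..u $ j})" by (simp add: S_def PiE_UNIV_domain)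
      then show "v \<in> vec_lambda ` Pi\<^sub>E UNIV (\<lambda>j. real ` {..u $ j})"
        by (intro image_eqI[of _ _ "vec_nth v"]) simp_all
    qed
  qed (intro finite_imageI finite_PiE; simp)
  moreover have "ip_feasible A b u \<subseteq> S"
  proof
    fix v assume v: "v \<in> ip_feasible A b u"
    have "v $ j \<in> real ` {..u $ j}" for j
    proof -
      have "v $ j \<in> \<int>" "0 \<le> v $ j" "v $ j \<le> real (u $ j)"
        using v by (auto simp: ip_feasible_def lp_feasible_def)
      then obtain n :: nat where "v $ j = real n"
        by (metis Ints_cases of_int_0_le_iff of_int_of_nat_eq zero_le_imp_eq_int)
      then show ?thesis using \<open>v $ j \<le> real (u $ j)\<close> by auto
    qed
    then show "v \<in> S" by (simp add: S_def)
  qed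
  ultimately show ?thesis by (rule finite_subset[rotated])
qed

text \<open>The step \<open>(j, r)\<close> moves from distance \<open>r\<close> towards \<open>r + 1\<close> along coordinate \<open>j\<close>, truncated at
  \<open>\<bar>d $ j\<bar>\<close>; \<open>G\<close> collects the steps of full length.\<close>

lemma conformal_cycle:
  fixes M :: "real ^ 'n ^ 'm" and d :: "real ^ 'n"
  assumes bd: "\<And>i j. \<bar>M $ i $ j\<bar> \<le> D" and int: "\<And>i j. M $ i $ j \<in> \<int>" and D: "0 \<le> D"
    and Md: "M *v d = 0" and few: "card {j. d $ j \<notin> \<int>} \<le> CARD('m)"
    and large: "l1_norm d > real CARD('m) * (2 * real CARD('m) * D + 1) ^ CARD('m)"
  obtains y where "M *v y = 0" and "\<And>j. y $ j \<in> \<int>" and "y \<noteq> 0"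
    and "\<And>j. \<exists>t. 0 \<le> t \<and> t \<le> \<bar>d $ j\<bar> \<and> y $ j = sgn (d $ j) * t"
proof -
  define I where "I = (SIGMA j:UNIV. {..<nat \<lceil>\<bar>d $ j\<bar>\<rceil>})"
  define G where "G = {(j, r) \<in> I. real r + 1 \<le> \<bar>d $ j\<bar>}"
  define x where "x = (\<lambda>(j, r). (sgn (d $ j) * min 1 (\<bar>d $ j\<bar> - real r)) *\<^sub>R column j M)"
  have fin: "finite I" by (simp add: I_def)
  have I: "real r < \<bar>d $ j\<bar>" if "(j, r) \<in> I" for j r
    using that unfolding I_def by simp linarith
  have GI: "G \<subseteq> I" by (auto simp: G_def)
  have sum0: "(\<Sum>i\<in>I. x i) = 0"
  proof -
    have "(\<Sum>i\<in>I. x i) = (\<Sum>j\<in>UNIV. \<Sum>r<nat \<lceil>\<bar>d $ j\<bar>\<rceil>. x (j, r))"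
      unfolding I_def by (subst sum.Sigma) (auto simp: case_prod_beta)
    also have "\<dots> = (\<Sum>j\<in>UNIV. (sgn (d $ j) * (\<Sum>r<nat \<lceil>\<bar>d $ j\<bar>\<rceil>. min 1 (\<bar>d $ j\<bar> - real r))) *\<^sub>R column j M)"
      by (simp add: x_def scaleR_sum_left[symmetric] sum_distrib_left[symmetric])
    also have "\<dots> = M *v d"
      by (simp add: sum_unit_pieces sgn_mult_abs matrix_vector_mult_columns)
    finally show ?thesis using Md by simp
  qed
  have xbd: "\<bar>x i $ l\<bar> \<le> D" if "i \<in> I" for i l
  proof -
    obtain j r where i: "i = (j, r)" by (cases i)
    have "\<bar>sgn (d $ j) * min 1 (\<bar>d $ j\<bar> - real r)\<bar> \<le> 1"
      using I[of j r] that i by (auto simp: abs_mult sgn_if)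
    then have "\<bar>sgn (d $ j) * min 1 (\<bar>d $ j\<bar> - real r)\<bar> * \<bar>M $ l $ j\<bar> \<le> 1 * D"
      using bd by (intro mult_mono) auto
    then show ?thesis by (simp add: i x_def column_def abs_mult)
  qed
  have xG: "x (j, r) = sgn (d $ j) *\<^sub>R column j M" if "(j, r) \<in> G" for j r
    using that by (simp add: x_def G_def)
  have xint: "x i $ l \<in> \<int>" if "i \<in> G" for i l
  proof -
    obtain j r where i: "i = (j, r)" by (cases i)
    have "sgn (d $ j) \<in> \<int>" by (auto simp: sgn_if)
    then show ?thesis using that int by (simp add: i xG column_def)
  qed
  have card: "card (I - G) \<le> CARD('m)"
  proof -
    \<comment> \<open>A step short of full length is the last one of a non-integral coordinate, so
      each such coordinate contributes at most one.\<close>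
    have h: "d $ j \<notin> \<int> \<and> r = nat \<lfloor>\<bar>d $ j\<bar>\<rfloor>" if jr: "(j, r) \<in> I - G" for j r
    proof -
      have r: "real r < \<bar>d $ j\<bar>" "\<bar>d $ j\<bar> < real r + 1" using jr I by (auto simp: G_def)
      then have "r = nat \<lfloor>\<bar>d $ j\<bar>\<rfloor>" by linarith
      moreover have "d $ j \<notin> \<int>"
      proof
        assume "d $ j \<in> \<int>"
        then obtain a where "\<bar>d $ j\<bar> = of_int a" by (metis Ints_abs Ints_cases)
        then have "int r < a" "a < int r + 1" using r by linarith+
        then show False by simp
      qed
      ultimately show ?thesis by simp
    qed
    have "inj_on fst (I - G)"
      by (rule inj_onI) (use h in \<open>metis prod.collapse\<close>)
    moreover have "fst ` (I - G) \<subseteq> {j. d $ j \<notin> \<int>}" using h by auto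
    ultimately have "card (I - G) \<le> card {j. d $ j \<notin> \<int>}"
      by (intro card_inj_on_le) auto
    then show ?thesis using few by simp
  qed
  have "l1_norm d \<le> (\<Sum>j\<in>UNIV. real (nat \<lceil>\<bar>d $ j\<bar>\<rceil>))"
    unfolding l1_norm_def by (intro sum_mono) linarith
  also have "\<dots> = real (card I)" by (simp add: I_def)
  finally have many: "real (card I) > real CARD('m) * (2 * real CARD('m) * D + 1) ^ CARD('m)"
    using large by linarith
  obtain J where J: "J \<subseteq> G" "J \<noteq> {}" "(\<Sum>i\<in>J. x i) = 0"
    using integral_zero_sum_subset[OF fin sum0 xbd D GI xint card many] by blast
  define n where "n j = card {r. (j, r) \<in> J}" for j
  \<comment> \<open>Steps in \<open>J\<close> have full length, so only their number along each
    coordinate matters. At most floor of |d_j| full steps exist there, hence \<open>y\<close> is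
    conformal to \<open>d\<close>.\<close>
  define y where "y = (\<chi> j. sgn (d $ j) * real (n j))"
  have subr: "{r. (j, r) \<in> J} \<subseteq> {..<nat \<lfloor>\<bar>d $ j\<bar>\<rfloor>}" for j
  proof
    fix r assume "r \<in> {r. (j, r) \<in> J}"
    then have "real r + 1 \<le> \<bar>d $ j\<bar>" using J(1) by (auto simp: G_def)
    then show "r \<in> {..<nat \<lfloor>\<bar>d $ j\<bar>\<rfloor>}" by simp linarith
  qed
  have finr: "finite {r. (j, r) \<in> J}" for j using subr by (rule finite_subset) simp
  have nle: "real (n j) \<le> \<bar>d $ j\<bar>" for j
  proof -
    have "n j \<le> nat \<lfloor>\<bar>d $ j\<bar>\<rfloor>" using card_mono[OF _ subr[of j]] by (simp add: n_def)
    then show ?thesis by linarith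
  qed
  show thesis
  proof (rule that[of y])
    have JS: "(SIGMA j:UNIV. {r. (j, r) \<in> J}) = J" by auto
    have "(\<Sum>i\<in>J. x i) = (\<Sum>j\<in>UNIV. \<Sum>r\<in>{r. (j, r) \<in> J}. x (j, r))"
      using finr sum.Sigma[of UNIV "\<lambda>j. {r. (j, r) \<in> J}" "\<lambda>j r. x (j, r)"] by (simp add: JS)
    also have "\<dots> = (\<Sum>j\<in>UNIV. \<Sum>r\<in>{r. (j, r) \<in> J}. sgn (d $ j) *\<^sub>R column j M)"
      using J(1) xG by (intro sum.cong) auto
    also have "\<dots> = M *v y"
      unfolding matrix_vector_mult_columns
      by (intro sum.cong) (auto simp: y_def n_def sum_constant_scaleR mult.commute simp del: sum_constant)
    finally show "M *v y = 0" using J(3) by simp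
    show "y $ j \<in> \<int>" for j by (auto simp: y_def sgn_if)
    obtain j r where jr: "(j, r) \<in> J" using J(2) by auto
    then have "n j > 0" using finr[of j] by (auto simp: n_def card_gt_0_iff)
    moreover have "d $ j \<noteq> 0" using jr J(1) I[of j r] by (auto simp: G_def)
    ultimately have "y $ j \<noteq> 0" by (simp add: y_def sgn_if)
    then show "y \<noteq> 0" by auto
    show "\<exists>t. 0 \<le> t \<and> t \<le> \<bar>d $ j\<bar> \<and> y $ j = sgn (d $ j) * t" for j
      using nle by (intro exI[of _ "real (n j)"]) (simp add: y_def)
  qed
qed

section \<open>Exchange between the vertex and a closest integer optimum\<close>

theorem theorem4:
  fixes A :: "int ^ 'n ^ 'm" and b :: "int ^ 'm" and c :: "int ^ 'n" and u :: "nat ^ 'n"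
    and \<Delta> :: real and xstar :: "real ^ 'n"
  assumes "\<And>i j. real_of_int \<bar>A $ i $ j\<bar> \<le> \<Delta>"
    and "ip_feasible A b u \<noteq> {}"
    and "optimal_solution c (lp_feasible A b u) xstar"
    and "xstar extreme_point_of lp_feasible A b u"
  shows "\<exists>zstar. optimal_solution c (ip_feasible A b u) zstar \<and>
    l1_norm (zstar - xstar) \<le> real CARD('m) * (2 * real CARD('m) * \<Delta> + 1) ^ CARD('m)"
proof -
  define M where "M = map_matrix real_of_int A"
  define Opt where "Opt = {z. optimal_solution c (ip_feasible A b u) z}"
  have "Opt \<subseteq> ip_feasible A b u" by (auto simp: Opt_def optimal_solution_def)
  then have finO: "finite Opt" using finite_ip_feasible by (rule finite_subset)
  have neO: "Opt \<noteq> {}"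
  proof -
    define s where "s = Max ((\<lambda>v. real_vec c \<bullet> v) ` ip_feasible A b u)"
    have "s \<in> (\<lambda>v. real_vec c \<bullet> v) ` ip_feasible A b u"
      unfolding s_def using finite_ip_feasible assms(2) by (intro Max_in) auto
    then obtain v where v: "v \<in> ip_feasible A b u" "s = real_vec c \<bullet> v" by auto
    moreover have "real_vec c \<bullet> y \<le> s" if "y \<in> ip_feasible A b u" for y
      unfolding s_def using that finite_ip_feasible[of A b u] by (intro Max_ge) auto
    ultimately have "v \<in> Opt" by (simp add: Opt_def optimal_solution_def)
    then show ?thesis by auto
  qed
  obtain z where z: "z \<in> Opt" and zmin: "\<And>v. v \<in> Opt \<Longrightarrow> l1_norm (z - xstar) \<le> l1_norm (v - xstar)"
    using ex_min_if_finite[of "(\<lambda>v. l1_norm (v - xstar)) ` Opt"] finO neO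
    by (metis (no_types, lifting) finite_imageI image_iff image_is_empty not_le)
  have zint: "z $ j \<in> \<int>" for j
    using z by (auto simp: Opt_def optimal_solution_def ip_feasible_def)
  have zfeas: "z \<in> lp_feasible A b u"
    using z by (auto simp: Opt_def optimal_solution_def ip_feasible_def)
  have xfeas: "xstar \<in> lp_feasible A b u"
    using assms(3) by (auto simp: optimal_solution_def)
  define d where "d = z - xstar"
  have "l1_norm d \<le> real CARD('m) * (2 * real CARD('m) * \<Delta> + 1) ^ CARD('m)"
  proof (rule ccontr)
    assume "\<not> ?thesis"
    then have large: "l1_norm d > real CARD('m) * (2 * real CARD('m) * \<Delta> + 1) ^ CARD('m)" by simp
    have Mbd: "\<bar>M $ i $ j\<bar> \<le> \<Delta>" for i j using assms(1)[of i j] by (simp add: M_def map_matrix_def)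
    have Mint: "M $ i $ j \<in> \<int>" for i j by (simp add: M_def map_matrix_def)
    have D: "0 \<le> \<Delta>" using Mbd by (meson abs_ge_zero order_trans)
    have Mz: "M *v z = real_vec b" and Mx: "M *v xstar = real_vec b"
      using zfeas xfeas by (auto simp: M_def lp_feasible_def)
    then have Md: "M *v d = 0" by (simp add: d_def matrix_vector_mult_diff_distrib)
    have "d $ j \<in> \<int>" if "xstar $ j \<in> \<int>" for j
      using that zint by (simp add: d_def)
    then have "card {j. d $ j \<notin> \<int>} \<le> card {j. xstar $ j \<notin> \<int>}" by (intro card_mono) auto
    then have few: "card {j. d $ j \<notin> \<int>} \<le> CARD('m)"
      using vertex_few_fractional[OF assms(4)] by simp
    obtain y where y: "M *v y = 0" "\<And>j. y $ j \<in> \<int>" "y \<noteq> 0"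
      "\<And>j. \<exists>t. 0 \<le> t \<and> t \<le> \<bar>d $ j\<bar> \<and> y $ j = sgn (d $ j) * t"
      using conformal_cycle[OF Mbd Mint D Md few large] by blast
    \<comment> \<open>\<open>y $ j\<close> has the sign of \<open>d $ j\<close> and is no longer, so
      subtracting it cancels exactly its own length. Hence \<open>z - y\<close> and
      \<open>xstar + y\<close> lie coordinatewise between \<open>xstar\<close> and
      \<open>z\<close>.\<close>
    have dist: "\<bar>d $ j - y $ j\<bar> = \<bar>d $ j\<bar> - \<bar>y $ j\<bar>" for j
      using y(4)[of j] by (auto simp: sgn_if split: if_splits)
    have bz: "0 \<le> z $ j" "z $ j \<le> real (u $ j)" "0 \<le> xstar $ j" "xstar $ j \<le> real (u $ j)" for j
      using zfeas xfeas by (auto simp: lp_feasible_def)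
    have bounds: "0 \<le> z $ j - y $ j \<and> z $ j - y $ j \<le> real (u $ j)
        \<and> 0 \<le> xstar $ j + y $ j \<and> xstar $ j + y $ j \<le> real (u $ j)" for j
      using dist[of j] bz[of j] unfolding d_def vector_minus_component by linarith
    have "xstar + y \<in> lp_feasible A b u"
      using bounds Mx y(1) by (simp add: lp_feasible_def M_def[symmetric] matrix_vector_right_distrib)
    then have "real_vec c \<bullet> (xstar + y) \<le> real_vec c \<bullet> xstar"
      using assms(3) by (auto simp: optimal_solution_def)
    \<comment> \<open>Optimality of \<open>xstar\<close> in the relaxation shows that removing
      \<open>y\<close> from \<open>z\<close> loses no objective value.\<close>
    then have cy: "real_vec c \<bullet> y \<le> 0" by (simp add: inner_add_right)
    have "z - y \<in> ip_feasible A b u"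
      using bounds Mz y(1,2) zint
      by (simp add: ip_feasible_def lp_feasible_def M_def[symmetric] matrix_vector_mult_diff_distrib)
    moreover have "real_vec c \<bullet> v \<le> real_vec c \<bullet> (z - y)" if "v \<in> ip_feasible A b u" for v
      using that z cy by (force simp: Opt_def optimal_solution_def inner_diff_right)
    ultimately have "z - y \<in> Opt" by (simp add: Opt_def optimal_solution_def)
    \<comment> \<open>Minimality of \<open>z\<close> forbids the distance to drop, yet it drops by
      the norm of the nonzero \<open>y\<close>.\<close>
    then have "l1_norm d \<le> l1_norm (d - y)"
      using zmin[of "z - y"] by (simp add: d_def algebra_simps)
    also have "\<dots> = l1_norm d - l1_norm y"
      by (simp add: l1_norm_def dist sum_subtractf)
    finally have "l1_norm y \<le> 0" by simp
    then have "l1_norm y = 0" by (simp add: l1_norm_def order.antisym sum_nonneg)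
    then have "y = 0" by (simp add: l1_norm_def vec_eq_iff sum_nonneg_eq_0_iff)
    then show False using y(3) by simp
  qed
  then show ?thesis using z by (auto simp: d_def Opt_def)
qed

end
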